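(* Let $m,k,n$ be positive integers. The set $SAT_{\mathbb{Q}^m}(\mathbb{Z}^m,k,n)\subset \mathbb{Z}^{n(k+m)}$ is generic (i.e. has asymptotic density $1$) if $n\le k$, and negligible (i.e. has asymptotic density $0$) if $n>k$.
   Context: A system of $n$ equations in $k$ variables over the free abelian group $\mathbb{Z}^m$ is written $AX=B$ with $A\in\mathbb{Z}^{n\times k}$ and $B\in\mathbb{Z}^{n\times m}$, and unknown matrix $X$ with $k$ rows $\mathbf{x}_1,\dots,\mathbf{x}_k$; it is identified with the integer matrix $(A|B)\in\mathbb{Z}^{n(k+m)}$. The space of all such systems is therefore $\mathbb{Z}^{n(k+m)}$. The system is solvable in $\mathbb{Q}^m$ if there is $X\in\mathbb{Q}^{k\times m}$ (each $\mathbf{x}_j\in\mathbb{Q}^m$) with $AX=B$. $SAT_{\mathbb{Q}^m}(\mathbb{Z}^m,k,n)$ is the set of all $(A|B)\in\mathbb{Z}^{n(k+m)}$ such that $AX=B$ is solvable in $\mathbb{Q}^m$. For a positive integer $N$ let $\|v\|_\infty=\max_i|v_i|$ and $B_r^N=\{v\in\mathbb{Z}^N : \|v\|_\infty\le r\}$. For $M\subset\mathbb{Z}^N$ the asymptotic density is $\rho(M)=\lim_{r\to\infty}|M\cap B_r^N|/|B_r^N|$ (over $r\in\mathbb{N}$) when the limit exists. $M$ is generic if $\rho(M)=1$ and negligible if $\rho(M)=0$. *)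

theory Defs
  imports Complex_Main "Jordan_Normal_Form.Matrix"
begin

text \<open>The lattice \<open>\<int>\<^sup>N\<close> is \<^term>\<open>carrier_vec N :: int vec set\<close>. The maximum below ranges over a
  nonempty set, as intended, only for vectors of positive dimension.\<close>

definition sup_norm :: "int vec \<Rightarrow> int" where
  "sup_norm v = Max ((\<lambda>i. \<bar>v $ i\<bar>) ` {..<dim_vec v})"

definition lattice_ball :: "nat \<Rightarrow> nat \<Rightarrow> int vec set" where
  "lattice_ball N r = {v \<in> carrier_vec N. sup_norm v \<le> int r}"

definition has_asymptotic_density :: "nat \<Rightarrow> int vec set \<Rightarrow> real \<Rightarrow> bool" where
  "has_asymptotic_density N M d \<longleftrightarrow>
     (\<lambda>r. real (card (M \<inter> lattice_ball N r)) / real (card (lattice_ball N r))) \<longlonglongrightarrow> d"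

definition generic :: "nat \<Rightarrow> int vec set \<Rightarrow> bool" where
  "generic N M \<longleftrightarrow> M \<subseteq> carrier_vec N \<and> has_asymptotic_density N M 1"

definition negligible :: "nat \<Rightarrow> int vec set \<Rightarrow> bool" where
  "negligible N M \<longleftrightarrow> M \<subseteq> carrier_vec N \<and> has_asymptotic_density N M 0"

text \<open>The two lower blocks have no rows.\<close>

definition augmented_mat :: "'a::zero mat \<Rightarrow> 'a mat \<Rightarrow> 'a mat" where
  "augmented_mat A B =
     four_block_mat A B (0\<^sub>m 0 (dim_col A)) (0\<^sub>m 0 (dim_col B))"

text \<open>Row by row: this identifies \<open>p \<times> q\<close> matrices with vectors of length \<open>p * q\<close>.\<close>

definition flatten_mat :: "'a mat \<Rightarrow> 'a vec" where
  "flatten_mat C =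
     vec (dim_row C * dim_col C) (\<lambda>i. C $$ (i div dim_col C, i mod dim_col C))"

text \<open>Row \<open>j\<close> of \<open>X\<close> is the value in \<open>\<rat>\<^sup>m\<close> of the \<open>j\<close>-th variable.\<close>

definition solvable_over_rat :: "nat \<Rightarrow> nat \<Rightarrow> int mat \<Rightarrow> int mat \<Rightarrow> bool" where
  "solvable_over_rat m k A B \<longleftrightarrow>
     (\<exists>X \<in> carrier_mat k m. map_mat rat_of_int A * X = map_mat rat_of_int B)"

definition SAT_rat :: "nat \<Rightarrow> nat \<Rightarrow> nat \<Rightarrow> int vec set" where
  "SAT_rat m k n =
     {flatten_mat (augmented_mat A B) | A B.
        A \<in> carrier_mat n k \<and> B \<in> carrier_mat n m \<and> solvable_over_rat m k A B}"

end

theory Submission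
  imports Defs "Jordan_Normal_Form.Determinant"
begin

text \<open>
  Solvability of \<open>AX = B\<close> over the rationals is controlled, in each of the two regimes, by a single
  leading minor of the augmented matrix \<open>(A|B)\<close>.

  If \<open>n \<le> k\<close>, the leading \<open>n \<times> n\<close> block lies inside \<open>A\<close>. When its determinant is nonzero, the
  system is solved by inverting that block and setting the other \<open>k - n\<close> variables to \<open>0\<close>
  (\<open>solvable_if_leading_minor_nonzero\<close>); so every unsolvable system has this minor zero.

  If \<open>n > k\<close>, the leading \<open>(k + 1) \<times> (k + 1)\<close> block consists of the first \<open>k + 1\<close> rows of \<open>A\<close> and
  of the first column of \<open>B\<close>. A solution writes that last column as a combination of the others,
  so every solvable system has this minor zero (\<open>leading_minor_zero_if_solvable\<close>).

  It remains to see that the vanishing of a given leading minor is a negligible event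
  (\<open>negligible_leading_minor_zero\<close>). This is elementary counting. Expanded along its last row, the
  minor of size \<open>s + 1\<close> is an affine function of its corner entry, whose slope is the minor of
  size \<open>s\<close>. Where the smaller minor is nonzero and the larger one vanishes, the corner entry is
  therefore determined by all other entries, which leaves at most \<open>(2r + 1) ^ (N - 1)\<close> of the
  \<open>(2r + 1) ^ N\<close> points of the ball of radius \<open>r\<close> (\<open>negligible_if_coordinate_determined\<close>). The remaining
  case, a vanishing smaller minor, is covered by induction on \<open>s\<close>.
\<close>

section \<open>Lattice balls and negligible sets\<close>

lemma lattice_ball_eq:
  assumes "N > 0"
  shows "lattice_ball N r = {v \<in> carrier_vec N. \<forall>i<N. v $ i \<in> {- int r..int r}}"
proof -
  have "sup_norm v \<le> int r \<longleftrightarrow> (\<forall>i<N. v $ i \<in> {- int r..int r})" if "v \<in> carrier_vec N" for v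
  proof -
    have "{..<N} \<noteq> {}" using assms by auto
    then have "sup_norm v \<le> int r \<longleftrightarrow> (\<forall>i<N. \<bar>v $ i\<bar> \<le> int r)"
      using that unfolding sup_norm_def by (subst Max_le_iff) auto
    then show ?thesis by (simp add: abs_le_iff minus_le_iff conj_commute)
  qed
  then show ?thesis unfolding lattice_ball_def by blast
qed

lemma bij_betw_lattice_ball:
  assumes "N > 0"
  shows "bij_betw (vec N) ({..<N} \<rightarrow>\<^sub>E {- int r..int r}) (lattice_ball N r)"
  unfolding bij_betw_def
proof
  show "inj_on (vec N) ({..<N} \<rightarrow>\<^sub>E {- int r..int r})"
  proof (rule inj_onI)
    fix f g
    assume "f \<in> {..<N} \<rightarrow>\<^sub>E {- int r..int r}" "g \<in> {..<N} \<rightarrow>\<^sub>E {- int r..int r}"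
      and "vec N f = vec N g"
    then show "f = g" by (metis PiE_ext index_vec lessThan_iff)
  qed
  show "vec N ` ({..<N} \<rightarrow>\<^sub>E {- int r..int r}) = lattice_ball N r"
  proof (intro equalityI subsetI)
    fix v assume "v \<in> lattice_ball N r"
    then have "v \<in> carrier_vec N" "\<forall>i<N. v $ i \<in> {- int r..int r}"
      using lattice_ball_eq[OF assms] by auto
    then have "v = vec N (restrict (($) v) {..<N})"
      and "restrict (($) v) {..<N} \<in> {..<N} \<rightarrow>\<^sub>E {- int r..int r}"
      by (auto simp: PiE_iff)
    then show "v \<in> vec N ` ({..<N} \<rightarrow>\<^sub>E {- int r..int r})" by blast
  next
    fix v assume "v \<in> vec N ` ({..<N} \<rightarrow>\<^sub>E {- int r..int r})"
    then obtain f where "v = vec N f" "\<forall>i<N. f i \<in> {- int r..int r}" by (auto simp: PiE_iff)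
    then show "v \<in> lattice_ball N r" unfolding lattice_ball_eq[OF assms] by simp
  qed
qed

lemma card_symmetric_interval: "card {- int r..int r} = 2 * r + 1"
  unfolding card_atLeastAtMost_int by linarith

lemma card_lattice_ball:
  assumes "N > 0"
  shows "card (lattice_ball N r) = (2 * r + 1) ^ N"
  using bij_betw_same_card[OF bij_betw_lattice_ball[OF assms, of r]]
  by (simp add: card_PiE card_symmetric_interval del: card_atLeastAtMost_int)

lemma finite_lattice_ball:
  assumes "N > 0"
  shows "finite (lattice_ball N r)"
  using card_lattice_ball[OF assms, of r] by (intro card_ge_0_finite) simp

lemma tendsto_0_if_squeezed:
  fixes g :: "nat \<Rightarrow> real"
  assumes "\<And>r. real (a r) / real (b r) \<le> g r" and "g \<longlonglongrightarrow> 0"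
  shows "(\<lambda>r. real (a r) / real (b r)) \<longlonglongrightarrow> 0"
  by (rule tendsto_sandwich[OF _ _ tendsto_const assms(2)])
     (simp_all add: assms(1))

lemma negligible_empty: "negligible N {}"
  by (simp add: negligible_def has_asymptotic_density_def)

lemma negligible_subset:
  assumes "N > 0" and Z: "negligible N Z" and "M \<subseteq> Z"
  shows "negligible N M"
proof -
  have "card (M \<inter> lattice_ball N r) \<le> card (Z \<inter> lattice_ball N r)" for r
    using assms by (intro card_mono) (auto simp: finite_lattice_ball)
  then have "real (card (M \<inter> lattice_ball N r)) / real (card (lattice_ball N r))
      \<le> real (card (Z \<inter> lattice_ball N r)) / real (card (lattice_ball N r))" for r
    by (intro divide_right_mono of_nat_mono) simp_all
  moreover have "(\<lambda>r. real (card (Z \<inter> lattice_ball N r)) / real (card (lattice_ball N r))) \<longlonglongrightarrow> 0"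
    using Z unfolding negligible_def has_asymptotic_density_def by blast
  ultimately have "(\<lambda>r. real (card (M \<inter> lattice_ball N r)) / real (card (lattice_ball N r))) \<longlonglongrightarrow> 0"
    by (intro tendsto_0_if_squeezed)
  moreover have "M \<subseteq> carrier_vec N" using assms unfolding negligible_def by blast
  ultimately show ?thesis unfolding negligible_def has_asymptotic_density_def by blast
qed

lemma negligible_Un:
  assumes Z: "negligible N Z" and W: "negligible N W"
  shows "negligible N (Z \<union> W)"
proof -
  let ?d = "\<lambda>M r. real (card (M \<inter> lattice_ball N r)) / real (card (lattice_ball N r))"
  have le: "?d (Z \<union> W) r \<le> ?d Z r + ?d W r" for r
    unfolding add_divide_distrib[symmetric] Int_Un_distrib2
    by (intro divide_right_mono) (simp_all add: card_Un_le flip: of_nat_add)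
  have "(\<lambda>r. ?d Z r + ?d W r) \<longlonglongrightarrow> 0 + 0"
    using Z W unfolding negligible_def has_asymptotic_density_def by (intro tendsto_add) auto
  then have "?d (Z \<union> W) \<longlonglongrightarrow> 0"
    by (intro tendsto_0_if_squeezed[OF le]) simp
  moreover have "Z \<union> W \<subseteq> carrier_vec N" using Z W unfolding negligible_def by blast
  ultimately show ?thesis unfolding negligible_def has_asymptotic_density_def by blast
qed

lemma generic_if_negligible_complement:
  assumes "N > 0" and M: "M \<subseteq> carrier_vec N" and Z: "negligible N (carrier_vec N - M)"
  shows "generic N M"
proof -
  let ?d = "\<lambda>M r. real (card (M \<inter> lattice_ball N r)) / real (card (lattice_ball N r))"
  have "1 - ?d (carrier_vec N - M) r = ?d M r" for r
  proof -
    have "lattice_ball N r = (M \<inter> lattice_ball N r) \<union> ((carrier_vec N - M) \<inter> lattice_ball N r)"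
      by (auto simp: lattice_ball_def)
    moreover have "card \<dots> = card (M \<inter> lattice_ball N r) + card ((carrier_vec N - M) \<inter> lattice_ball N r)"
      using assms(1) by (intro card_Un_disjoint) (auto simp: finite_lattice_ball)
    ultimately have "real (card (lattice_ball N r)) =
        real (card (M \<inter> lattice_ball N r)) + real (card ((carrier_vec N - M) \<inter> lattice_ball N r))"
      by simp
    moreover have "real (card (lattice_ball N r)) \<noteq> 0"
      using card_lattice_ball[OF assms(1), of r] by simp
    ultimately show ?thesis by (simp add: field_simps)
  qed
  moreover have "(\<lambda>r. 1 - ?d (carrier_vec N - M) r) \<longlonglongrightarrow> 1 - 0"
    using Z unfolding negligible_def has_asymptotic_density_def by (intro tendsto_diff) auto
  ultimately show ?thesis
    using M by (simp add: generic_def has_asymptotic_density_def)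
qed

text \<open>Forgetting the \<open>i\<close>-th coordinate is injective on such a set, so it meets the ball of radius
  \<open>r\<close> in a fraction of at most \<open>1 / (2r + 1)\<close> of its points.\<close>

lemma negligible_if_coordinate_determined:
  assumes "i < N" and S: "S \<subseteq> carrier_vec N"
    and det: "\<And>v w. v \<in> S \<Longrightarrow> w \<in> S \<Longrightarrow> (\<And>j. j < N \<Longrightarrow> j \<noteq> i \<Longrightarrow> v $ j = w $ j) \<Longrightarrow> v $ i = w $ i"
  shows "negligible N S"
proof -
  have "N > 0" using \<open>i < N\<close> by simp
  let ?J = "{..<N} - {i}"
  have card_le: "card (S \<inter> lattice_ball N r) \<le> (2 * r + 1) ^ (N - 1)" for r
  proof -
    let ?f = "\<lambda>v. restrict (($) v) ?J"
    have "inj_on ?f (S \<inter> lattice_ball N r)"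
    proof (rule inj_onI)
      fix v w assume vw: "v \<in> S \<inter> lattice_ball N r" "w \<in> S \<inter> lattice_ball N r" and eq: "?f v = ?f w"
      have *: "v $ j = w $ j" if "j < N" "j \<noteq> i" for j
        using fun_cong[OF eq, of j] that by simp
      then have "v $ i = w $ i" using vw by (intro det) auto
      with * have "\<forall>j<N. v $ j = w $ j" by metis
      moreover have "v \<in> carrier_vec N" "w \<in> carrier_vec N" using vw S by auto
      ultimately show "v = w" by (intro eq_vecI) auto
    qed
    moreover have "?f ` (S \<inter> lattice_ball N r) \<subseteq> ?J \<rightarrow>\<^sub>E {- int r..int r}"
      unfolding lattice_ball_eq[OF \<open>N > 0\<close>]
      by (intro image_subsetI) (simp only: restrict_PiE_iff, blast)
    moreover have "finite (?J \<rightarrow>\<^sub>E {- int r..int r})" by (intro finite_PiE) auto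
    ultimately have "card (S \<inter> lattice_ball N r) \<le> card (?J \<rightarrow>\<^sub>E {- int r..int r})"
      by (rule card_inj_on_le)
    also have "\<dots> = (2 * r + 1) ^ (N - 1)"
      using \<open>i < N\<close> by (simp add: card_PiE card_symmetric_interval del: card_atLeastAtMost_int)
    finally show ?thesis .
  qed
  have "real (card (S \<inter> lattice_ball N r)) / real (card (lattice_ball N r)) \<le> inverse (real (Suc r))" for r
  proof -
    have "real (card (S \<inter> lattice_ball N r)) / real (card (lattice_ball N r))
        \<le> real ((2 * r + 1) ^ (N - 1)) / real ((2 * r + 1) ^ N)"
      unfolding card_lattice_ball[OF \<open>N > 0\<close>] by (intro divide_right_mono of_nat_mono card_le) simp
    also have "\<dots> = 1 / real (2 * r + 1)"
      using \<open>N > 0\<close> unfolding of_nat_power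
      by (subst power_eq_if) (simp add: divide_simps flip: of_nat_Suc)
    \<comment> \<open>A weaker bound, which is a standard null sequence.\<close>
    also have "\<dots> \<le> inverse (real (Suc r))" by (simp add: field_simps)
    finally show ?thesis .
  qed
  then have "(\<lambda>r. real (card (S \<inter> lattice_ball N r)) / real (card (lattice_ball N r))) \<longlonglongrightarrow> 0"
    by (rule tendsto_0_if_squeezed[OF _ LIMSEQ_inverse_real_of_nat])
  then show ?thesis using S by (simp add: negligible_def has_asymptotic_density_def)
qed

section \<open>Vanishing leading minors\<close>

text \<open>The vector is read as a matrix with rows of length \<open>p\<close>, listed one after another.\<close>

definition leading_block :: "nat \<Rightarrow> nat \<Rightarrow> 'a vec \<Rightarrow> 'a mat" where
  "leading_block p s v = mat s s (\<lambda>(i, j). v $ (i * p + j))"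

lemma leading_block_carrier [simp]: "leading_block p s v \<in> carrier_mat s s"
  by (simp add: leading_block_def)

text \<open>The cofactors along the last row do not involve that row, so the Laplace expansions of the two
  determinants differ only in the term of the corner entry.\<close>

lemma det_diff_last_entry:
  fixes C D :: "'a::comm_ring_1 mat"
  assumes C: "C \<in> carrier_mat (Suc s) (Suc s)" and D: "D \<in> carrier_mat (Suc s) (Suc s)"
    and eq: "\<And>i j. i < Suc s \<Longrightarrow> j < Suc s \<Longrightarrow> (i, j) \<noteq> (s, s) \<Longrightarrow> C $$ (i, j) = D $$ (i, j)"
  shows "det C - det D = (C $$ (s, s) - D $$ (s, s)) * det (mat_delete C s s)"
proof -
  have del: "mat_delete C s j = mat_delete D s j" for j
    using C D by (intro eq_matI) (auto simp: mat_delete_def intro!: eq)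
  have "det C - det D = (\<Sum>j<Suc s. (C $$ (s, j) - D $$ (s, j)) * cofactor C s j)"
    using C D by (simp add: laplace_expansion_row[of _ "Suc s" s] cofactor_def del
        algebra_simps sum_subtractf del: sum.lessThan_Suc)
  also have "\<dots> = (C $$ (s, s) - D $$ (s, s)) * cofactor C s s"
    by (simp add: eq)
  also have "cofactor C s s = det (mat_delete C s s)"
    by (simp add: cofactor_def flip: mult_2)
  finally show ?thesis .
qed

text \<open>The minors of sizes \<open>s\<close> and \<open>s + 1\<close> are compared. If both vanish, the induction hypothesis
  applies; if only the larger one does, the coordinate \<open>s * p + s\<close>, which holds the corner entry, is
  determined by the others. The induction starts at \<open>s = 0\<close>, where the empty determinant is \<open>1\<close>.\<close>

lemma negligible_leading_minor_zero:
  assumes "s \<le> n" and "s \<le> p" and "n * p > 0"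
  shows "negligible (n * p) {v \<in> carrier_vec (n * p). det (leading_block p s v) = 0}"
  using assms(1,2)
proof (induction s)
  case 0
  then show ?case by (simp add: leading_block_def negligible_empty)
next
  case (Suc s)
  let ?Z = "\<lambda>t. {v \<in> carrier_vec (n * p). det (leading_block p t v) = (0::int)}"
  have pos: "s * p + s < n * p"
  proof -
    have "s * p + s < Suc s * p" using Suc.prems by simp
    also have "\<dots> \<le> n * p" using Suc.prems by (intro mult_right_mono) auto
    finally show ?thesis .
  qed
  have "negligible (n * p) (?Z (Suc s) - ?Z s)"
  proof (rule negligible_if_coordinate_determined[OF pos])
    fix v w assume v: "v \<in> ?Z (Suc s) - ?Z s" and w: "w \<in> ?Z (Suc s) - ?Z s"
      and eq: "\<And>j. j < n * p \<Longrightarrow> j \<noteq> s * p + s \<Longrightarrow> v $ j = w $ j"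
    let ?C = "leading_block p (Suc s) v" and ?D = "leading_block p (Suc s) w"
    have "det ?C - det ?D = (?C $$ (s, s) - ?D $$ (s, s)) * det (mat_delete ?C s s)"
    proof (rule det_diff_last_entry)
      fix i j assume ij: "i < Suc s" "j < Suc s" "(i, j) \<noteq> (s, s)"
      have "i * p + j < Suc i * p" using ij Suc.prems by simp
      also have "\<dots> \<le> n * p" using ij Suc.prems by (intro mult_right_mono) auto
      finally have "i * p + j < n * p" .
      moreover have "i * p + j \<noteq> s * p + s"
      proof
        assume e: "i * p + j = s * p + s"
        have "j < p" "s < p" using ij Suc.prems by auto
        then have "i = s" using arg_cong[OF e, of "\<lambda>x. x div p"] by simp
        with e ij show False by simp
      qed
      ultimately show "?C $$ (i, j) = ?D $$ (i, j)" using ij eq by (simp add: leading_block_def)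
    qed simp_all
    moreover have "mat_delete ?C s s = leading_block p s v"
      by (intro eq_matI) (auto simp: mat_delete_def leading_block_def)
    ultimately show "v $ (s * p + s) = w $ (s * p + s)"
      using v w by (simp add: leading_block_def)
  qed auto
  with Suc have "negligible (n * p) ((?Z (Suc s) - ?Z s) \<union> ?Z s)"
    by (intro negligible_Un) simp_all
  then show ?case by (rule negligible_subset[OF assms(3)]) blast
qed

section \<open>Solvability and leading minors\<close>

lemma flatten_augmented_index:
  assumes "A \<in> carrier_mat n k" "B \<in> carrier_mat n m" "i < n" "j < k + m"
  shows "flatten_mat (augmented_mat A B) $ (i * (k + m) + j) =
    (if j < k then A $$ (i, j) else B $$ (i, j - k))"
proof -
  have "i * (k + m) + j < Suc i * (k + m)" using assms by simp
  also have "\<dots> \<le> n * (k + m)" using assms by (intro mult_right_mono) auto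
  finally have "i * (k + m) + j < n * (k + m)" .
  then show ?thesis
    using assms by (auto simp: flatten_mat_def augmented_mat_def Let_def)
qed

lemma flatten_augmented_carrier:
  assumes "A \<in> carrier_mat n k" "B \<in> carrier_mat n m"
  shows "flatten_mat (augmented_mat A B) \<in> carrier_vec (n * (k + m))"
  using assms by (simp add: flatten_mat_def augmented_mat_def)

lemma SAT_rat_carrier: "SAT_rat m k n \<subseteq> carrier_vec (n * (k + m))"
  by (auto simp: SAT_rat_def flatten_augmented_carrier)

lemma flatten_augmented_surj:
  assumes "v \<in> carrier_vec (n * (k + m))" and "k + m > 0"
  obtains A B where "A \<in> carrier_mat n k" "B \<in> carrier_mat n m"
    "v = flatten_mat (augmented_mat A B)"
proof
  let ?A = "mat n k (\<lambda>(i, j). v $ (i * (k + m) + j))"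
  let ?B = "mat n m (\<lambda>(i, j). v $ (i * (k + m) + (k + j)))"
  show AB: "?A \<in> carrier_mat n k" "?B \<in> carrier_mat n m" by simp_all
  show "v = flatten_mat (augmented_mat ?A ?B)"
  proof (rule eq_vecI)
    show "dim_vec v = dim_vec (flatten_mat (augmented_mat ?A ?B))"
      using assms flatten_augmented_carrier[OF AB] by auto
    fix l assume "l < dim_vec (flatten_mat (augmented_mat ?A ?B))"
    then have l: "l < n * (k + m)" using flatten_augmented_carrier[OF AB] by simp
    define i j where "i = l div (k + m)" and "j = l mod (k + m)"
    have ij: "i < n" "j < k + m" "l = i * (k + m) + j"
      using l assms(2) unfolding i_def j_def
      by (simp_all only: less_mult_imp_div_less mod_less_divisor div_mult_mod_eq)
    show "v $ l = flatten_mat (augmented_mat ?A ?B) $ l"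
      unfolding ij(3) flatten_augmented_index[OF AB ij(1,2)] using ij(1,2) by auto
  qed
qed

text \<open>Invert the leading block and give the variables beyond the \<open>n\<close>-th the value \<open>0\<close>.\<close>

lemma solvable_if_leading_minor_nonzero:
  assumes A: "A \<in> carrier_mat n k" and B: "B \<in> carrier_mat n m" and "n \<le> k"
    and nz: "det (mat n n (\<lambda>(i, j). A $$ (i, j))) \<noteq> 0"
  shows "solvable_over_rat m k A B"
proof -
  define A0 where "A0 = map_mat rat_of_int (mat n n (\<lambda>(i, j). A $$ (i, j)))"
  define B0 where "B0 = map_mat rat_of_int B"
  \<comment> \<open>The adjugate over the determinant serves as the inverse of the block.\<close>
  define Y where "Y = inverse (det A0) \<cdot>\<^sub>m (adj_mat A0 * B0)"
  define X where "X = mat k m (\<lambda>(i, j). if i < n then Y $$ (i, j) else 0)"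
  have A0: "A0 \<in> carrier_mat n n" and B0: "B0 \<in> carrier_mat n m" using B by (simp_all add: A0_def B0_def)
  have "det A0 \<noteq> 0" using nz by (simp add: A0_def of_int_hom.hom_det)
  note adj = adj_mat[OF A0]
  have Y: "Y \<in> carrier_mat n m" using adj B0 by (simp add: Y_def)
  have "A0 * Y = inverse (det A0) \<cdot>\<^sub>m ((A0 * adj_mat A0) * B0)"
    unfolding Y_def assoc_mult_mat[OF A0 adj(1) B0]
    by (rule mult_smult_distrib[OF A0 mult_carrier_mat[OF adj(1) B0]])
  also have "\<dots> = B0"
    unfolding adj(2) mult_smult_assoc_mat[OF one_carrier_mat B0]
    using \<open>det A0 \<noteq> 0\<close> B0 by (intro eq_matI) simp_all
  finally have AY: "A0 * Y = B0" .
  have "map_mat rat_of_int A * X = B0"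
  proof (rule eq_matI)
    fix i j assume "i < dim_row B0" "j < dim_col B0"
    then have ij: "i < n" "j < m" using B0 by auto
    have "(map_mat rat_of_int A * X) $$ (i, j) =
        (\<Sum>l<k. rat_of_int (A $$ (i, l)) * (if l < n then Y $$ (l, j) else 0))"
      using A ij by (auto simp: scalar_prod_def X_def lessThan_atLeast0 intro!: sum.cong)
    also have "\<dots> = (\<Sum>l<n. rat_of_int (A $$ (i, l)) * Y $$ (l, j))"
      using \<open>n \<le> k\<close> by (intro sum.mono_neutral_cong_right) auto
    also have "\<dots> = (A0 * Y) $$ (i, j)"
      using A0 Y ij by (auto simp: scalar_prod_def A0_def lessThan_atLeast0 intro!: sum.cong)
    finally show "(map_mat rat_of_int A * X) $$ (i, j) = B0 $$ (i, j)" by (simp add: AY)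
  qed (use A B0 in \<open>auto simp: X_def\<close>)
  moreover have "X \<in> carrier_mat k m" by (simp add: X_def)
  ultimately show ?thesis unfolding solvable_over_rat_def B0_def by blast
qed

text \<open>If \<open>x\<close> is the first column of a solution, then \<open>(x, -1)\<close> is a nonzero kernel vector of the
  block formed by the first \<open>k\<close> columns of \<open>A\<close> and the first column of \<open>B\<close>. The hypothesis \<open>m > 0\<close>
  guarantees that \<open>B\<close> has a column, \<open>k < n\<close> that there are \<open>k + 1\<close> rows.\<close>

lemma leading_minor_zero_if_solvable:
  assumes A: "A \<in> carrier_mat n k" and B: "B \<in> carrier_mat n m" and "k < n" and "m > 0"
    and sol: "solvable_over_rat m k A B"
  shows "det (leading_block (k + m) (Suc k) (flatten_mat (augmented_mat A B))) = 0"
proof -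
  obtain X where X: "X \<in> carrier_mat k m" and AX: "map_mat rat_of_int A * X = map_mat rat_of_int B"
    using sol unfolding solvable_over_rat_def by blast
  define D where "D = map_mat rat_of_int (leading_block (k + m) (Suc k) (flatten_mat (augmented_mat A B)))"
  have D: "D \<in> carrier_mat (Suc k) (Suc k)" by (simp add: D_def)
  define z where "z = vec (Suc k) (\<lambda>j. if j < k then X $$ (j, 0) else - 1)"
  have z: "z \<in> carrier_vec (Suc k)" by (simp add: z_def)
  have D_entry: "D $$ (i, j) = rat_of_int (if j < k then A $$ (i, j) else B $$ (i, 0))"
    if "i < Suc k" "j < Suc k" for i j
    using that assms(3,4) flatten_augmented_index[OF A B, of i j]
    by (auto simp: D_def leading_block_def)
  have "D *\<^sub>v z = 0\<^sub>v (Suc k)"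
  proof (rule eq_vecI)
    fix i assume "i < dim_vec (0\<^sub>v (Suc k) :: rat vec)"
    then have i: "i < Suc k" by simp
    then have "i < n" using \<open>k < n\<close> by simp
    have "(D *\<^sub>v z) $ i = (\<Sum>j<Suc k. D $$ (i, j) * z $ j)"
      using D z i by (auto simp: scalar_prod_def lessThan_atLeast0 intro!: sum.cong)
    also have "\<dots> = (\<Sum>j<k. rat_of_int (A $$ (i, j)) * X $$ (j, 0)) - rat_of_int (B $$ (i, 0))"
      using i by (simp add: D_entry z_def)
    also have "(\<Sum>j<k. rat_of_int (A $$ (i, j)) * X $$ (j, 0)) = (map_mat rat_of_int A * X) $$ (i, 0)"
      using A X \<open>i < n\<close> \<open>m > 0\<close> by (auto simp: scalar_prod_def lessThan_atLeast0 intro!: sum.cong)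
    also have "\<dots> = rat_of_int (B $$ (i, 0))"
      using B \<open>i < n\<close> \<open>m > 0\<close> by (simp add: AX)
    finally show "(D *\<^sub>v z) $ i = 0\<^sub>v (Suc k) $ i" using i by simp
  qed (use D in auto)
  moreover have "z \<noteq> 0\<^sub>v (Suc k)"
  proof
    assume "z = 0\<^sub>v (Suc k)"
    then have "z $ k = 0\<^sub>v (Suc k) $ k" by simp
    then show False by (simp add: z_def)
  qed
  ultimately have "det D = 0"
    using det_0_iff_vec_prod_zero_field[OF D] z by blast
  then show ?thesis by (simp add: D_def of_int_hom.hom_det)
qed

theorem theorem3p2:
  fixes m k n :: nat
  assumes "m > 0" and "k > 0" and "n > 0"
  shows "(n \<le> k \<longrightarrow> generic (n * (k + m)) (SAT_rat m k n)) \<and>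
         (n > k \<longrightarrow> negligible (n * (k + m)) (SAT_rat m k n))"
proof (intro conjI impI)
  let ?N = "n * (k + m)"
  let ?Z = "\<lambda>s. {v \<in> carrier_vec ?N. det (leading_block (k + m) s v) = (0::int)}"
  have N: "?N > 0" using assms by simp
  {
    assume "n \<le> k"
    have "carrier_vec ?N - SAT_rat m k n \<subseteq> ?Z n"
    proof
      fix v assume v: "v \<in> carrier_vec ?N - SAT_rat m k n"
      then obtain A B where AB: "A \<in> carrier_mat n k" "B \<in> carrier_mat n m"
        and v_eq: "v = flatten_mat (augmented_mat A B)"
        using flatten_augmented_surj[of v n k m] assms by auto
      have "leading_block (k + m) n v = mat n n (\<lambda>(i, j). A $$ (i, j))"
        using \<open>n \<le> k\<close> by (intro eq_matI) (auto simp: leading_block_def v_eq flatten_augmented_index[OF AB])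
      then show "v \<in> ?Z n"
        using v AB v_eq solvable_if_leading_minor_nonzero[OF AB \<open>n \<le> k\<close>]
        by (auto simp: SAT_rat_def)
    qed
    moreover have "negligible ?N (?Z n)"
      using \<open>n \<le> k\<close> N by (intro negligible_leading_minor_zero) auto
    ultimately show "generic ?N (SAT_rat m k n)"
      using generic_if_negligible_complement[OF N SAT_rat_carrier] negligible_subset[OF N] by blast
  next
    assume "n > k"
    have "SAT_rat m k n \<subseteq> ?Z (Suc k)"
      using leading_minor_zero_if_solvable \<open>n > k\<close> \<open>m > 0\<close>
      by (auto simp: SAT_rat_def flatten_augmented_carrier)
    moreover have "negligible ?N (?Z (Suc k))"
      using \<open>n > k\<close> \<open>m > 0\<close> N by (intro negligible_leading_minor_zero) auto
    ultimately show "negligible ?N (SAT_rat m k n)"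
      using negligible_subset[OF N] by blast
  }
qed

end
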